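(* Let $X$ be a real Banach space, $K$ a nonempty subset of $X$, $A\colon X\to X^*$, $\varphi\colon X\times X\to\mathbb{R}$, $j\colon X\to\mathbb{R}$ locally Lipschitz, and $f\in X^*$. Assume that the variational-hemivariational inequality: find $u\in K$ such that $$\langle Au,v-u\rangle+\varphi(u,v)-\varphi(u,u)+j^0(u;v-u)\ge\langle f,v-u\rangle\quad\forall\,v\in K\qquad(\mathrm{VHI})$$ is well-posed, and let $u$ be its unique solution. For each $n\in\mathbb{N}$ let $\varphi_n\colon X\times X\to\mathbb{R}$, let $j_n\colon X\to\mathbb{R}$ be locally Lipschitz, let $f_n\in X^*$, and assume there exist $b_n>0$ and $c_n>0$ such that $$\varphi_n(u,v)-\varphi_n(u,u)-\varphi(u,v)+\varphi(u,u)\le b_n\|u-v\|_X\quad\forall\,u,v\in X,$$ $$j_n^0(u;v-u)-j^0(u;v-u)\le c_n\|u-v\|_X\quad\forall\,u,v\in X.$$ Assume that $b_n\to0$, $c_n\to0$ and $f_n\to f$ in $X^*$ as $n\to\infty$. For each $n\in\mathbb{N}$, let $u_n\in K$ be a solution of $$\langle Au_n,v-u_n\rangle+\varphi_n(u_n,v)-\varphi_n(u_n,u_n)+j_n^0(u_n;v-u_n)\ge\langle f_n,v-u_n\rangle\quad\forall\,v\in K.$$ Then $u_n\to u$ in $X$.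
   Context: $\langle\cdot,\cdot\rangle$ is the duality pairing between $X^*$ and $X$; $\to$ in $X$ and $X^*$ denotes norm convergence. For a locally Lipschitz function $j\colon X\to\mathbb{R}$ (each point has a neighborhood on which $j$ is Lipschitz continuous), the generalized (Clarke) directional derivative of $j$ at $u$ in the direction $v$ is $j^0(u;v)=\limsup_{x\to u,\ \lambda\downarrow0}\frac{j(x+\lambda v)-j(x)}{\lambda}$. A sequence $\{u_n\}\subset K$ is an approximating sequence for (VHI) if there exists a sequence $\{\varepsilon_n\}\subset\mathbb{R}$ with $0<\varepsilon_n\to0$ such that for each $n\in\mathbb{N}$ $$\langle Au_n,v-u_n\rangle+\varphi(u_n,v)-\varphi(u_n,u_n)+j^0(u_n;v-u_n)\ge\langle f,v-u_n\rangle-\varepsilon_n\|u_n-v\|_X\quad\forall\,v\in K.$$ (VHI) is well-posed (in the sense of Tykhonov) if it has a unique solution and every approximating sequence for (VHI) converges strongly in $X$ to that solution. *)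

theory Defs
  imports "HOL-Analysis.Analysis"
begin

definition locally_lipschitz :: "('a::metric_space \<Rightarrow> 'b::metric_space) \<Rightarrow> bool" where
  "locally_lipschitz j \<longleftrightarrow> (\<forall>x. \<exists>U L. open U \<and> x \<in> U \<and> L-lipschitz_on U j)"

(* The upper limit is taken in the extended reals. For locally Lipschitz j it is finite
   (lemma ereal_clarke_deriv below), so that real_of_ereal loses no information.
   As usual for Clarke's derivative, x ranges over a full neighbourhood of u, u included. *)
definition clarke_deriv :: "('a::real_normed_vector \<Rightarrow> real) \<Rightarrow> 'a \<Rightarrow> 'a \<Rightarrow> real" where
  "clarke_deriv j u v =
     real_of_ereal (Limsup (nhds u \<times>\<^sub>F at_right 0)
       (\<lambda>(x, t). ereal ((j (x + t *\<^sub>R v) - j x) / t)))"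

lemma ereal_clarke_deriv:
  fixes j :: "'a::real_normed_vector \<Rightarrow> real"
  assumes "locally_lipschitz j"
  shows "ereal (clarke_deriv j u v) =
    Limsup (nhds u \<times>\<^sub>F at_right 0) (\<lambda>(x, t). ereal ((j (x + t *\<^sub>R v) - j x) / t))"
proof -
  let ?F = "nhds u \<times>\<^sub>F at_right (0::real)"
  let ?q = "\<lambda>(x, t). ereal ((j (x + t *\<^sub>R v) - j x) / t)"
  obtain U L where U: "open U" "u \<in> U" and L: "L-lipschitz_on U j"
    using assms unfolding locally_lipschitz_def by blast
  have "((\<lambda>p. fst p) \<longlongrightarrow> u) ?F"
    by (rule filterlim_fst)
  moreover have "((\<lambda>p. snd p) \<longlongrightarrow> 0) ?F"
    using filterlim_mono[OF filterlim_snd[of "at_right (0::real)" "nhds u"] at_within_le_nhds order_refl] .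
  ultimately have "((\<lambda>p. fst p + snd p *\<^sub>R v) \<longlongrightarrow> u + 0 *\<^sub>R v) ?F"
    by (intro tendsto_intros)
  then have ev1: "eventually (\<lambda>p. fst p + snd p *\<^sub>R v \<in> U) ?F"
    using U by (intro topological_tendstoD) auto
  have ev2: "eventually (\<lambda>p. fst p \<in> U) ?F"
    using \<open>((\<lambda>p. fst p) \<longlongrightarrow> u) ?F\<close> U by (intro topological_tendstoD) auto
  have ev3: "eventually (\<lambda>p. snd p > 0) ?F"
    using filterlim_snd[of "at_right (0::real)" "nhds u"] eventually_at_right_less[of "0::real"]
    unfolding filterlim_iff by blast
  have bnd: "\<bar>(j (x + t *\<^sub>R v) - j x) / t\<bar> \<le> L * norm v"
    if "x + t *\<^sub>R v \<in> U" "x \<in> U" "t > 0" for x t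
  proof -
    have "\<bar>j (x + t *\<^sub>R v) - j x\<bar> \<le> L * (t * norm v)"
      using lipschitz_onD[OF L that(1,2)] that(3) by (simp add: dist_norm)
    with that(3) show ?thesis
      by (simp add: field_simps)
  qed
  have ev: "eventually (\<lambda>p. ?q p \<le> ereal (L * norm v) \<and> ereal (- (L * norm v)) \<le> ?q p) ?F"
    using ev1 ev2 ev3
  proof eventually_elim
    case (elim p)
    then have "\<bar>(j (fst p + snd p *\<^sub>R v) - j (fst p)) / snd p\<bar> \<le> L * norm v"
      by (rule bnd)
    then show ?case
      unfolding abs_le_iff case_prod_beta ereal_less_eq by linarith
  qed
  have nt: "?F \<noteq> bot"
    by (simp add: prod_filter_eq_bot)
  have "Limsup ?F ?q \<le> ereal (L * norm v)"
    by (rule Limsup_bounded) (use ev in \<open>auto elim: eventually_mono\<close>)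
  moreover have "ereal (- (L * norm v)) \<le> Liminf ?F ?q"
    by (rule Liminf_bounded) (use ev in \<open>auto elim: eventually_mono\<close>)
  then have "ereal (- (L * norm v)) \<le> Limsup ?F ?q"
    using Liminf_le_Limsup[OF nt] order_trans by blast
  ultimately have "\<bar>Limsup ?F ?q\<bar> \<noteq> \<infinity>"
    by auto
  then show ?thesis
    unfolding clarke_deriv_def by (simp add: ereal_real')
qed

definition vhi_solution ::
  "'a::real_normed_vector set \<Rightarrow> ('a \<Rightarrow> 'a \<Rightarrow>\<^sub>L real) \<Rightarrow> ('a \<Rightarrow> 'a \<Rightarrow> real) \<Rightarrow> ('a \<Rightarrow> real)
    \<Rightarrow> ('a \<Rightarrow>\<^sub>L real) \<Rightarrow> 'a \<Rightarrow> bool" where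
  "vhi_solution K A \<phi> j f u \<longleftrightarrow> u \<in> K \<and>
     (\<forall>v\<in>K. blinfun_apply (A u) (v - u) + \<phi> u v - \<phi> u u + clarke_deriv j u (v - u)
        \<ge> blinfun_apply f (v - u))"

definition vhi_approximating ::
  "'a::real_normed_vector set \<Rightarrow> ('a \<Rightarrow> 'a \<Rightarrow>\<^sub>L real) \<Rightarrow> ('a \<Rightarrow> 'a \<Rightarrow> real) \<Rightarrow> ('a \<Rightarrow> real)
    \<Rightarrow> ('a \<Rightarrow>\<^sub>L real) \<Rightarrow> (nat \<Rightarrow> 'a) \<Rightarrow> bool" where
  "vhi_approximating K A \<phi> j f s \<longleftrightarrow> (\<forall>n. s n \<in> K) \<and>
     (\<exists>\<epsilon>::nat \<Rightarrow> real. (\<forall>n. 0 < \<epsilon> n) \<and> \<epsilon> \<longlonglongrightarrow> 0 \<and>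
       (\<forall>n. \<forall>v\<in>K.
          blinfun_apply (A (s n)) (v - s n) + \<phi> (s n) v - \<phi> (s n) (s n)
            + clarke_deriv j (s n) (v - s n)
          \<ge> blinfun_apply f (v - s n) - \<epsilon> n * norm (s n - v)))"

definition vhi_well_posed ::
  "'a::real_normed_vector set \<Rightarrow> ('a \<Rightarrow> 'a \<Rightarrow>\<^sub>L real) \<Rightarrow> ('a \<Rightarrow> 'a \<Rightarrow> real) \<Rightarrow> ('a \<Rightarrow> real)
    \<Rightarrow> ('a \<Rightarrow>\<^sub>L real) \<Rightarrow> bool" where
  "vhi_well_posed K A \<phi> j f \<longleftrightarrow>
     (\<exists>!u. vhi_solution K A \<phi> j f u) \<and>
     (\<forall>u s. vhi_solution K A \<phi> j f u \<longrightarrow> vhi_approximating K A \<phi> j f s \<longrightarrow> s \<longlonglongrightarrow> u)"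

end

theory Submission
  imports Defs
begin

text \<open>
  The hypotheses on \<open>\<phi>\<^sub>n\<close> and \<open>j\<^sub>n\<close> are one-sided: passing from \<open>\<phi>\<close>, \<open>j\<close> to \<open>\<phi>\<^sub>n\<close>, \<open>j\<^sub>n\<close> raises the larger
  side of the inequality at \<open>u\<^sub>n\<close> by at most \<open>(b\<^sub>n + c\<^sub>n) \<parallel>u\<^sub>n - v\<parallel>\<close>. Only this direction matters, since the
  inequality that \<open>u\<^sub>n\<close> satisfies is transferred back to the original data. Replacing \<open>f\<^sub>n\<close> by \<open>f\<close> costs
  at most \<open>\<parallel>f\<^sub>n - f\<parallel> \<parallel>u\<^sub>n - v\<parallel>\<close>. Hence \<open>u\<^sub>n\<close> solves the original problem up to the defect \<open>\<epsilon>\<^sub>n \<parallel>u\<^sub>n - v\<parallel>\<close> with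
  \<open>\<epsilon>\<^sub>n = b\<^sub>n + c\<^sub>n + \<parallel>f\<^sub>n - f\<parallel>\<close>, as \<open>perturbed_vhi_solution_defect\<close> records. This is exactly the error allowed
  in an approximating sequence, and \<open>\<epsilon>\<^sub>n\<close> tends to \<open>0\<close>, so well-posedness supplies the convergence.
\<close>

text \<open>
  The term with \<open>A\<close> is common to both problems, the terms with \<open>\<phi>\<close> and the Clarke derivatives are
  compared by hypothesis, and the operator norm controls \<open>f' - f\<close>.
\<close>

lemma perturbed_vhi_solution_defect:
  assumes sol: "vhi_solution K A \<phi>' j' f' u"
    and phi: "\<phi>' u v - \<phi>' u u - \<phi> u v + \<phi> u u \<le> b * norm (u - v)"
    and clarke: "clarke_deriv j' u (v - u) - clarke_deriv j u (v - u) \<le> c * norm (u - v)"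
    and "v \<in> K"
  shows "blinfun_apply (A u) (v - u) + \<phi> u v - \<phi> u u + clarke_deriv j u (v - u)
    \<ge> blinfun_apply f (v - u) - (b + c + norm (f' - f)) * norm (u - v)"
proof -
  have "norm (blinfun_apply (f' - f) (v - u)) \<le> norm (f' - f) * norm (v - u)"
    by (rule norm_blinfun)
  then have "blinfun_apply f (v - u) - norm (f' - f) * norm (u - v) \<le> blinfun_apply f' (v - u)"
    by (simp add: blinfun.diff_left norm_minus_commute)
  moreover have "blinfun_apply (A u) (v - u) + \<phi>' u v - \<phi>' u u + clarke_deriv j' u (v - u)
      \<ge> blinfun_apply f' (v - u)"
    using sol \<open>v \<in> K\<close> unfolding vhi_solution_def by blast
  ultimately show ?thesis
    using phi clarke unfolding distrib_right by linarith
qed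

theorem theorem10:
  fixes K :: "'a::banach set"
    and A :: "'a \<Rightarrow> 'a \<Rightarrow>\<^sub>L real"
    and \<phi> :: "'a \<Rightarrow> 'a \<Rightarrow> real"
    and j :: "'a \<Rightarrow> real"
    and f :: "'a \<Rightarrow>\<^sub>L real"
    and u :: 'a
    and \<phi>n :: "nat \<Rightarrow> 'a \<Rightarrow> 'a \<Rightarrow> real"
    and jn :: "nat \<Rightarrow> 'a \<Rightarrow> real"
    and fn :: "nat \<Rightarrow> 'a \<Rightarrow>\<^sub>L real"
    and b c :: "nat \<Rightarrow> real"
    and un :: "nat \<Rightarrow> 'a"
  assumes "K \<noteq> {}"
    and "locally_lipschitz j"
    and "vhi_well_posed K A \<phi> j f"
    and "vhi_solution K A \<phi> j f u"
    and "\<And>n. locally_lipschitz (jn n)"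
    and "\<And>n. b n > 0"
    and "\<And>n. c n > 0"
    and "\<And>n x y. \<phi>n n x y - \<phi>n n x x - \<phi> x y + \<phi> x x \<le> b n * norm (x - y)"
    and "\<And>n x y. clarke_deriv (jn n) x (y - x) - clarke_deriv j x (y - x) \<le> c n * norm (x - y)"
    and "b \<longlonglongrightarrow> 0"
    and "c \<longlonglongrightarrow> 0"
    and "fn \<longlonglongrightarrow> f"
    and "\<And>n. vhi_solution K A (\<phi>n n) (jn n) (fn n) (un n)"
  shows "un \<longlonglongrightarrow> u"
proof -
  define \<epsilon> where "\<epsilon> n = b n + c n + norm (fn n - f)" for n
  have pos: "0 < \<epsilon> n" for n
    using \<open>b n > 0\<close> \<open>c n > 0\<close> by (simp add: \<epsilon>_def add_pos_nonneg)
  have "(\<lambda>n. norm (fn n - f)) \<longlonglongrightarrow> 0"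
    using \<open>fn \<longlonglongrightarrow> f\<close> by (simp add: LIM_zero tendsto_norm_zero)
  with \<open>b \<longlonglongrightarrow> 0\<close> \<open>c \<longlonglongrightarrow> 0\<close> have lim: "\<epsilon> \<longlonglongrightarrow> 0"
    unfolding \<epsilon>_def by (auto intro!: tendsto_add_zero)
  have "blinfun_apply (A (un n)) (v - un n) + \<phi> (un n) v - \<phi> (un n) (un n)
      + clarke_deriv j (un n) (v - un n)
    \<ge> blinfun_apply f (v - un n) - \<epsilon> n * norm (un n - v)" if "v \<in> K" for n v
    unfolding \<epsilon>_def using assms(13,8,9) that by (rule perturbed_vhi_solution_defect)
  moreover have "un n \<in> K" for n
    using assms(13) unfolding vhi_solution_def by blast
  ultimately have "vhi_approximating K A \<phi> j f un"
    unfolding vhi_approximating_def using pos lim by blast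
  then show ?thesis
    using assms(3,4) unfolding vhi_well_posed_def by blast
qed

end
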